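(* Let $A$ be a pre-structurable algebra over a field $F$, with unit element $e$ and involution $a\mapsto\bar a$. Then: (i) $Q(a,b,c)d$ is totally symmetric in $a,b,c,d\in A$. (ii) $Q(a,b,c)d=0$ whenever at least one of $a,b,c,d\in A$ is the unit element $e$. (iii) Suppose $F$ has characteristic $\neq 2$. Then $Q(a,b,c)d=0$ whenever at least one of $a,b,c,d\in A$ is an element of $H$. (iv) For all $a,b,c\in A$, $\overline{Q(a,b,c)}=Q(\bar a,\bar b,\bar c)=Q(a,b,c)$, and $Q(a,b,c)$ is a derivation of $A$. (v) For all $a,b,c\in A$, $3Q(a,b,c)=D(a,\bar b\,\bar c)+D(b,\bar c\,\bar a)+D(c,\bar a\,\bar b)$.
   Context: Let $A$ be a unital, not necessarily associative algebra over a field $F$ with unit element $e$ and an involution $a\mapsto\bar a$ (an $F$-linear map with $\bar{\bar a}=a$ and $\overline{ab}=\bar b\,\bar a$). Put $l(a)b=ab$, $r(a)b=ba$. For $a,b\in A$ define $t_j(a,b)\in\mathrm{End}\,A$, $j=0,1,2$, by $t_1(a,b)=l(\bar b)l(a)-l(\bar a)l(b)$, $t_2(a,b)=r(\bar b)r(a)-r(\bar a)r(b)$, $t_0(a,b)=r(\bar a b-\bar b a)+l(b)l(\bar a)-l(a)l(\bar b)$, with the index $j$ taken modulo $3$. For $P\in\mathrm{End}\,A$, define $\overline{P}\in\mathrm{End}\,A$ by $\overline{P}\,\bar a=\overline{Pa}$. The algebra $A$ is called pre-structurable if $\overline{t_j(a,b)}(cd)=(t_{j+1}(a,b)c)d+c(t_{j+2}(a,b)d)$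 for all $a,b,c,d\in A$ and $j=0,1,2$. Define $Q(a,b,c)=t_0(a,\bar b\,\bar c)+t_1(b,\bar c\,\bar a)+t_2(c,\bar a\,\bar b)\in\mathrm{End}\,A$, $D(a,b)=t_0(a,b)+t_1(a,b)+t_2(a,b)$, and $H=\{a\in A:\bar a=-a\}$. *)

theory Defs
  imports "HOL-Computational_Algebra.Computational_Algebra" "HOL-Combinatorics.Permutations"
begin

text \<open>
  The underlying vector space is a whole type \<open>'a\<close> over a field type \<open>'f\<close>, of arbitrary dimension.
  The product is an explicit operation because it need not be associative.
\<close>

locale involutive_algebra = vector_space scale
  for scale :: "'f::field \<Rightarrow> 'a::ab_group_add \<Rightarrow> 'a" +
  fixes mul :: "'a \<Rightarrow> 'a \<Rightarrow> 'a" (infixl \<open>\<cdot>\<close> 70)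
    and e :: 'a
    and bar :: "'a \<Rightarrow> 'a"
  assumes linear_mul_right: "\<And>a. Vector_Spaces.linear scale scale (\<lambda>b. a \<cdot> b)"
    and linear_mul_left: "\<And>b. Vector_Spaces.linear scale scale (\<lambda>a. a \<cdot> b)"
    and unit_left: "\<And>a. e \<cdot> a = a"
    and unit_right: "\<And>a. a \<cdot> e = a"
    and linear_bar: "Vector_Spaces.linear scale scale bar"
    and bar_bar: "\<And>a. bar (bar a) = a"
    and bar_mul: "\<And>a b. bar (a \<cdot> b) = bar b \<cdot> bar a"

definition lmul :: "('a \<Rightarrow> 'a \<Rightarrow> 'a) \<Rightarrow> 'a \<Rightarrow> 'a \<Rightarrow> 'a" where
  "lmul mul a = (\<lambda>b. mul a b)"

definition rmul :: "('a \<Rightarrow> 'a \<Rightarrow> 'a) \<Rightarrow> 'a \<Rightarrow> 'a \<Rightarrow> 'a" where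
  "rmul mul a = (\<lambda>b. mul b a)"

text \<open>The index is read modulo 3, so that \<open>t_op mul bar (j + 1)\<close> is meaningful for \<open>j = 2\<close>.\<close>

definition t_op ::
    "('a::ab_group_add \<Rightarrow> 'a \<Rightarrow> 'a) \<Rightarrow> ('a \<Rightarrow> 'a) \<Rightarrow> nat \<Rightarrow> 'a \<Rightarrow> 'a \<Rightarrow> ('a \<Rightarrow> 'a)" where
  "t_op mul bar j a b =
    (let l = lmul mul; r = rmul mul in
     if j mod 3 = 1 then (\<lambda>x. (l (bar b) \<circ> l a) x - (l (bar a) \<circ> l b) x)
     else if j mod 3 = 2 then (\<lambda>x. (r (bar b) \<circ> r a) x - (r (bar a) \<circ> r b) x)
     else (\<lambda>x. r (mul (bar a) b - mul (bar b) a) x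
                + (l b \<circ> l (bar a)) x - (l a \<circ> l (bar b)) x))"

text \<open>
  The operator \<open>P\<close>-bar is characterised by \<open>P\<close>-bar(\<open>bar a\<close>) \<open>=\<close> \<open>bar (P a)\<close>; as \<open>bar\<close> is
  its own inverse, this is the conjugate of \<open>P\<close> by \<open>bar\<close>.
\<close>

definition op_bar :: "('a \<Rightarrow> 'a) \<Rightarrow> ('a \<Rightarrow> 'a) \<Rightarrow> ('a \<Rightarrow> 'a)" where
  "op_bar bar P = (\<lambda>x. bar (P (bar x)))"

lemma (in involutive_algebra) op_bar_unique:
  "R = op_bar bar P \<longleftrightarrow> (\<forall>a. R (bar a) = bar (P a))"
proof
  assume "\<forall>a. R (bar a) = bar (P a)"
  then have "R (bar (bar x)) = bar (P (bar x))" for x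
    by blast
  then show "R = op_bar bar P"
    by (simp add: op_bar_def bar_bar fun_eq_iff)
qed (simp add: op_bar_def bar_bar)

locale pre_structurable_algebra = involutive_algebra +
  assumes pre_structurable: "\<And>j a b c d. j < 3 \<Longrightarrow>
    op_bar bar (t_op mul bar j a b) (c \<cdot> d) =
      t_op mul bar (j + 1) a b c \<cdot> d + c \<cdot> t_op mul bar (j + 2) a b d"

definition Q_op ::
    "('a::ab_group_add \<Rightarrow> 'a \<Rightarrow> 'a) \<Rightarrow> ('a \<Rightarrow> 'a) \<Rightarrow> 'a \<Rightarrow> 'a \<Rightarrow> 'a \<Rightarrow> ('a \<Rightarrow> 'a)" where
  "Q_op mul bar a b c =
    (\<lambda>x. t_op mul bar 0 a (mul (bar b) (bar c)) x
       + t_op mul bar 1 b (mul (bar c) (bar a)) x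
       + t_op mul bar 2 c (mul (bar a) (bar b)) x)"

definition D_op ::
    "('a::ab_group_add \<Rightarrow> 'a \<Rightarrow> 'a) \<Rightarrow> ('a \<Rightarrow> 'a) \<Rightarrow> 'a \<Rightarrow> 'a \<Rightarrow> ('a \<Rightarrow> 'a)" where
  "D_op mul bar a b =
    (\<lambda>x. t_op mul bar 0 a b x + t_op mul bar 1 a b x + t_op mul bar 2 a b x)"

definition skew_elements :: "('a::ab_group_add \<Rightarrow> 'a) \<Rightarrow> 'a set" where
  "skew_elements bar = {a. bar a = - a}"

definition derivation ::
    "('f::field \<Rightarrow> 'a::ab_group_add \<Rightarrow> 'a) \<Rightarrow> ('a \<Rightarrow> 'a \<Rightarrow> 'a) \<Rightarrow> ('a \<Rightarrow> 'a) \<Rightarrow> bool" where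
  "derivation scale mul P \<longleftrightarrow>
    Vector_Spaces.linear scale scale P \<and>
    (\<forall>x y. P (mul x y) = mul (P x) y + mul x (P y))"

definition totally_symmetric4 :: "('a \<Rightarrow> 'a \<Rightarrow> 'a \<Rightarrow> 'a \<Rightarrow> 'b) \<Rightarrow> bool" where
  "totally_symmetric4 f \<longleftrightarrow>
    (\<forall>\<sigma> (x :: nat \<Rightarrow> 'a). \<sigma> permutes {0..<4} \<longrightarrow>
       f (x (\<sigma> 0)) (x (\<sigma> 1)) (x (\<sigma> 2)) (x (\<sigma> 3)) = f (x 0) (x 1) (x 2) (x 3))"

end

theory Submission
  imports Defs
begin

text \<open>
  Comparing \<open>Q(a,b,c)d\<close> with \<open>Q(d,b,c)a\<close> term by term, their equality is the triality relation for
  \<open>t\<^sub>0(bar a, bar d)\<close> at \<open>bar b \<cdot> bar c\<close>, so \<open>Q\<close> is symmetric under exchanging \<open>a\<close> and \<open>d\<close>.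
  Adding up three triality relations gives
  \<open>bar (Q(a,b,c) (bar (x \<cdot> y))) = Q(c,a,b)x \<cdot> y + x \<cdot> Q(b,c,a)y\<close>. Since \<open>Q(a,b,c)e = 0\<close>, putting
  \<open>x = e\<close> or \<open>y = e\<close> shows that \<open>Q\<close> is cyclically symmetric in its first three arguments. The
  3-cycle and the transposition generate the symmetric group on four letters. The displayed relation
  then says that \<open>Q(a,b,c)\<close> is a derivation commuting with \<open>bar\<close>; by symmetry, barring any one
  argument bars the value, and since barring three of them has no effect, the values are fixed by
  \<open>bar\<close>. For skew \<open>d\<close> this gives \<open>Q(a,b,c)d = - Q(a,b,c)d\<close>.
\<close>

text \<open>Each adjacent transposition is a word in \<open>cyc\<close> and \<open>swap\<close>; an
  arbitrary permutation is then reached by induction, one transposition at a time.\<close>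

lemma totally_symmetric4I:
  assumes cyc: "\<And>a b c d. f a b c d = f b c a d"
    and swap: "\<And>a b c d. f a b c d = f d b c a"
  shows "totally_symmetric4 f"
  unfolding totally_symmetric4_def
proof (intro allI impI)
  have swap34: "f a b c d = f a b d c" for a b c d
    by (simp only: cyc[of c a b d, symmetric] swap[of c a b d] cyc[of d a b c])
  have swap23: "f a b c d = f a c b d" for a b c d
  proof -
    have "f a b c d = f b c d a"
      by (simp only: swap[of a b c d] cyc[of d b c a])
    also have "\<dots> = f d a c b"
      by (simp only: swap[of b c d a] cyc[of d a c b])
    also have "\<dots> = f a c b d"
      by (simp only: swap[of d a c b] cyc[of b a c d])
    finally show ?thesis .
  qed
  have swap12: "f a b c d = f b a c d" for a b c d
    by (simp only: cyc[of c a b d, symmetric] swap23[of c a b d] cyc[of c b a d])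
  have transp: "f (y (transpose i j 0)) (y (transpose i j 1)) (y (transpose i j 2)) (y (transpose i j 3))
      = f (y 0) (y 1) (y 2) (y 3)"
    if "i \<in> {0..<4}" "j \<in> {0..<4}" for i j and y :: "nat \<Rightarrow> 'a"
  proof -
    have "i = 0 \<or> i = 1 \<or> i = 2 \<or> i = 3" "j = 0 \<or> j = 1 \<or> j = 2 \<or> j = 3"
      using that by auto
    then show ?thesis
      \<comment> \<open>The three swap equations are permutative, so ordered rewriting sorts the
        arguments and both sides get the same normal form.\<close>
      by (elim disjE; simp add: transpose_def swap12 swap23 swap34)
  qed
  fix \<sigma> :: "nat \<Rightarrow> nat" and x :: "nat \<Rightarrow> 'a"
  assume "\<sigma> permutes {0..<4}"
  with finite_atLeastLessThan
  show "f (x (\<sigma> 0)) (x (\<sigma> 1)) (x (\<sigma> 2)) (x (\<sigma> 3)) = f (x 0) (x 1) (x 2) (x 3)"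
  proof (induction rule: permutes_rev_induct)
    case (swap i j p)
    then show ?case
      using transp[of i j "x \<circ> p"] by (simp del: One_nat_def)
  qed simp
qed

lemma (in vector_space) two_torsion_free:
  fixes x :: 'b
  assumes "CHAR('a) \<noteq> 2" "x = - x"
  shows "x = 0"
proof -
  have "scale 2 x = x + x"
    by (metis one_add_one scale_left_distrib scale_one)
  also have "\<dots> = 0"
    using assms(2) by (metis add.right_inverse)
  finally have "(2::'a) = 0 \<or> x = 0"
    by simp
  moreover have "(2::'a) \<noteq> 0"
  proof
    assume "(2::'a) = 0"
    then have "CHAR('a) dvd 2"
      by (metis of_nat_eq_0_iff_char_dvd of_nat_numeral)
    then show False
      using assms(1) CHAR_not_1 by (metis One_nat_def dvd_antisym prime_nat_iff two_is_prime_nat)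
  qed
  ultimately show ?thesis by blast
qed

section \<open>Multilinear calculus in an algebra with involution\<close>

context involutive_algebra
begin

abbreviation t :: "nat \<Rightarrow> 'a \<Rightarrow> 'a \<Rightarrow> 'a \<Rightarrow> 'a" where
  "t \<equiv> t_op (\<cdot>) bar"

abbreviation Q :: "'a \<Rightarrow> 'a \<Rightarrow> 'a \<Rightarrow> 'a \<Rightarrow> 'a" where
  "Q \<equiv> Q_op (\<cdot>) bar"

lemma
  shows mul_add_right: "a \<cdot> (b + c) = a \<cdot> b + a \<cdot> c"
    and mul_diff_right: "a \<cdot> (b - c) = a \<cdot> b - a \<cdot> c"
    and mul_zero_right: "a \<cdot> 0 = 0"
    and mul_scale_right: "a \<cdot> scale k b = scale k (a \<cdot> b)"
proof -
  interpret mul: Vector_Spaces.linear scale scale "\<lambda>b. a \<cdot> b"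
    by (fact linear_mul_right)
  show "a \<cdot> (b + c) = a \<cdot> b + a \<cdot> c" "a \<cdot> (b - c) = a \<cdot> b - a \<cdot> c" "a \<cdot> 0 = 0"
    "a \<cdot> scale k b = scale k (a \<cdot> b)"
    by (fact mul.add mul.diff mul.zero mul.scale)+
qed

lemma
  shows mul_add_left: "(a + b) \<cdot> c = a \<cdot> c + b \<cdot> c"
    and mul_diff_left: "(a - b) \<cdot> c = a \<cdot> c - b \<cdot> c"
    and mul_zero_left: "0 \<cdot> c = 0"
    and mul_scale_left: "scale k a \<cdot> c = scale k (a \<cdot> c)"
proof -
  interpret mul: Vector_Spaces.linear scale scale "\<lambda>a. a \<cdot> c"
    by (fact linear_mul_left)
  show "(a + b) \<cdot> c = a \<cdot> c + b \<cdot> c" "(a - b) \<cdot> c = a \<cdot> c - b \<cdot> c" "0 \<cdot> c = 0"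
    "scale k a \<cdot> c = scale k (a \<cdot> c)"
    by (fact mul.add mul.diff mul.zero mul.scale)+
qed

lemma
  shows bar_add: "bar (a + b) = bar a + bar b"
    and bar_diff: "bar (a - b) = bar a - bar b"
proof -
  interpret bar: Vector_Spaces.linear scale scale bar
    by (fact linear_bar)
  show "bar (a + b) = bar a + bar b" "bar (a - b) = bar a - bar b"
    by (fact bar.add bar.diff)+
qed

lemma bar_unit: "bar e = e"
  by (metis bar_bar bar_mul unit_left unit_right)

lemmas mul_distribs = mul_add_right mul_diff_right mul_zero_right mul_add_left mul_diff_left mul_zero_left

lemmas expand = mul_distribs bar_add bar_diff bar_mul bar_bar bar_unit unit_left unit_right

lemma t0: "t 0 a b x = x \<cdot> (bar a \<cdot> b - bar b \<cdot> a) + b \<cdot> (bar a \<cdot> x) - a \<cdot> (bar b \<cdot> x)"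
  by (simp add: t_op_def lmul_def rmul_def)

lemma t1: "t 1 a b x = bar b \<cdot> (a \<cdot> x) - bar a \<cdot> (b \<cdot> x)"
  by (simp add: t_op_def lmul_def)

lemma t2: "t 2 a b x = (x \<cdot> a) \<cdot> bar b - (x \<cdot> b) \<cdot> bar a"
  by (simp add: t_op_def rmul_def)

lemma Q_eq: "Q a b c x = t 0 a (bar b \<cdot> bar c) x + t 1 b (bar c \<cdot> bar a) x + t 2 c (bar a \<cdot> bar b) x"
  by (simp add: Q_op_def)

lemma linear_Q: "Vector_Spaces.linear scale scale (Q a b c)"
proof (unfold_locales)
  show "Q a b c (x + y) = Q a b c x + Q a b c y" for x y
    unfolding Q_eq t0 t1 t2 by (simp add: expand algebra_simps)
  show "Q a b c (scale k x) = scale k (Q a b c x)" for k x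
    unfolding Q_eq t0 t1 t2
    by (simp add: mul_scale_right mul_scale_left scale_right_distrib scale_right_diff_distrib)
qed

text \<open>Both sides contain the same nine \<open>t\<close> terms: each \<open>D_op\<close> groups
  them by argument pair, while the three rotations of \<open>Q\<close> take each pair once with
  every index.\<close>

lemma D_sum_eq:
  "D_op (\<cdot>) bar a (bar b \<cdot> bar c) x + D_op (\<cdot>) bar b (bar c \<cdot> bar a) x
     + D_op (\<cdot>) bar c (bar a \<cdot> bar b) x
   = Q a b c x + Q b c a x + Q c a b x"
  by (simp add: D_op_def Q_eq add_ac)

end

section \<open>Consequences of triality\<close>

context pre_structurable_algebra
begin

lemma
  shows triality0: "bar (t 0 a b (bar (c \<cdot> d))) = t 1 a b c \<cdot> d + c \<cdot> t 2 a b d"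
    and triality1: "bar (t 1 a b (bar (c \<cdot> d))) = t 2 a b c \<cdot> d + c \<cdot> t 0 a b d"
    and triality2: "bar (t 2 a b (bar (c \<cdot> d))) = t 0 a b c \<cdot> d + c \<cdot> t 1 a b d"
proof -
  have "t 3 = t 0" "t 4 = t 1"
    by (simp_all add: t_op_def fun_eq_iff)
  then show "bar (t 0 a b (bar (c \<cdot> d))) = t 1 a b c \<cdot> d + c \<cdot> t 2 a b d"
    "bar (t 1 a b (bar (c \<cdot> d))) = t 2 a b c \<cdot> d + c \<cdot> t 0 a b d"
    "bar (t 2 a b (bar (c \<cdot> d))) = t 0 a b c \<cdot> d + c \<cdot> t 1 a b d"
    using pre_structurable[of 0 a b c d] pre_structurable[of 1 a b c d]
      pre_structurable[of 2 a b c d]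
    by (simp_all add: op_bar_def numeral_eq_Suc)
qed

text \<open>Triality at \<open>d = e\<close> turns the left side into
  \<open>t 1 a b x + x \<cdot> t 2 a b e\<close>, which is exactly the formula defining
  \<open>t 0 (bar a) (bar b) x\<close>.\<close>

lemma bar_t0: "bar (t 0 a b (bar x)) = t 0 (bar a) (bar b) x"
  using triality0[of a b x e] unfolding t0 t1 t2 by (simp add: expand algebra_simps)

lemma Q_unit1: "Q e b c x = 0"
proof -
  have "bar (t 1 b (bar c) (bar x)) = t 2 b (bar c) x + x \<cdot> t 0 b (bar c) e"
    and "bar (t 1 (bar b) c (bar x)) = t 2 (bar b) c e \<cdot> x + t 0 (bar b) c x"
    using triality1[of b "bar c" x e] triality1[of "bar b" c e x]
    by (simp_all add: unit_left unit_right)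
  \<comment> \<open>Since \<open>bar (t 1 a b (bar x)) = t 2 (bar a) (bar b) x\<close> by expansion,
    the term \<open>t 2 b (bar c) x\<close> cancels against the last one, and what remains is
    \<open>Q e b c x\<close>.\<close>
  then have "t 2 b (bar c) x + x \<cdot> t 0 b (bar c) e - bar (t 1 b (bar c) (bar x))
      + (t 2 (bar b) c e \<cdot> x + t 0 (bar b) c x - bar (t 1 (bar b) c (bar x))) = 0"
    by simp
  then show ?thesis
    unfolding Q_eq t0 t1 t2 by (simp add: expand algebra_simps)
qed

lemma Q_swap: "Q a b c d = Q d b c a"
proof -
  have "t 0 a d (bar b \<cdot> bar c) = bar (t 0 (bar a) (bar d) (bar (bar b \<cdot> bar c)))"
    by (simp add: bar_t0 bar_bar)
  also have "\<dots> = t 1 (bar a) (bar d) (bar b) \<cdot> bar c + bar b \<cdot> t 2 (bar a) (bar d) (bar c)"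
    by (rule triality0)
  finally show ?thesis
    unfolding Q_eq t0 t1 t2 by (simp add: expand algebra_simps)
qed

lemma Q_unit4: "Q a b c e = 0"
  using Q_swap Q_unit1 by simp

text \<open>Triality raises every index by one on the left factor and by two on the right factor;
  regrouping by index rotates the arguments of \<open>Q\<close>.\<close>

lemma bar_Q_mul: "bar (Q a b c (bar (x \<cdot> y))) = Q c a b x \<cdot> y + x \<cdot> Q b c a y"
  unfolding Q_eq bar_add triality0 triality1 triality2 by (simp add: mul_distribs add_ac)

lemma bar_Q: "bar (Q a b c (bar x)) = Q b c a x"
  using bar_Q_mul[of a b c e x] by (simp add: unit_left Q_unit4 expand)

text \<open>The right unit and the left unit (\<open>bar_Q\<close>) evaluate the same barred
  expression, \<open>bar (Q c a b (bar x))\<close>, to two different rotations.\<close>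

lemma Q_cyc: "Q a b c x = Q b c a x"
  using bar_Q_mul[of c a b x e] bar_Q[of c a b x]
  by (simp add: unit_right Q_unit4 expand)

lemma Q_symmetric: "totally_symmetric4 Q"
  by (rule totally_symmetric4I) (fact Q_cyc Q_swap)+

lemma Q_move2: "Q a b c d = Q d c a b"
  by (subst Q_cyc) (rule Q_swap)

lemma Q_move3: "Q a b c d = Q d a b c"
  by (subst Q_cyc, subst Q_cyc) (rule Q_swap)

lemma Q_swap23: "Q a b c d = Q a c b d"
  by (simp only: Q_swap[of a b c d] Q_move2[of d b c a] Q_move3[of a c d b] Q_cyc[of b a c d])

section \<open>The involution, derivations and skew elements\<close>

lemma Q_bar4: "Q a b c (bar x) = bar (Q a b c x)"
  using bar_Q[of a b c "bar x"] Q_cyc[of a b c "bar x"] by (simp add: bar_bar)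

lemma
  shows Q_bar1: "Q (bar a) b c x = bar (Q a b c x)"
    and Q_bar2: "Q a (bar b) c x = bar (Q a b c x)"
    and Q_bar3: "Q a b (bar c) x = bar (Q a b c x)"
proof -
  show "Q (bar a) b c x = bar (Q a b c x)"
    by (simp only: Q_swap[of "bar a" b c x] Q_swap[of a b c x] Q_bar4)
  show "Q a (bar b) c x = bar (Q a b c x)"
    by (simp only: Q_move2[of a "bar b" c x] Q_move2[of a b c x] Q_bar4)
  show "Q a b (bar c) x = bar (Q a b c x)"
    by (simp only: Q_move3[of a b "bar c" x] Q_move3[of a b c x] Q_bar4)
qed

lemma Q_bars: "Q (bar a) (bar b) (bar c) x = Q a b c x"
proof -
  have "Q a b c x = bar (Q a b c (bar x))"
    by (simp add: Q_bar4 bar_bar)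
  \<comment> \<open>Conjugation by \<open>bar\<close> bars the arguments of each \<open>t\<close>,
    exchanging indices 1 and 2 and keeping 0; as \<open>bar\<close> also reverses products,
    \<open>b\<close> and \<open>c\<close> trade places.\<close>
  also have "\<dots> = Q (bar a) (bar c) (bar b) x"
    unfolding Q_eq bar_add bar_t0 unfolding t1 t2 by (simp add: expand add_ac)
  finally show ?thesis
    by (simp add: Q_swap23)
qed

lemma Q_derivation: "derivation scale (\<cdot>) (Q a b c)"
proof -
  have "Q a b c (x \<cdot> y) = Q a b c x \<cdot> y + x \<cdot> Q a b c y" for x y
    using bar_Q_mul[of a b c x y]
    by (simp add: Q_bar4 bar_bar Q_cyc[of c a b x] Q_cyc[of a b c y])
  then show ?thesis
    by (simp add: derivation_def linear_Q)
qed

lemma Q_unit: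
  assumes "e \<in> {a, b, c, d}"
  shows "Q a b c d = 0"
proof -
  consider "a = e" | "b = e" | "c = e" | "d = e"
    using assms by auto
  then show ?thesis
    by cases (simp_all only: Q_unit4 Q_swap[of e b c d] Q_move2[of a e c d] Q_move3[of a b e d])
qed

lemma bar_Q_fixed: "bar (Q a b c d) = Q a b c d"
proof -
  have "Q a b c d = Q (bar a) (bar b) (bar c) d"
    by (simp add: Q_bars)
  also have "\<dots> = bar (bar (bar (Q a b c d)))"
    by (simp add: Q_bar1 Q_bar2 Q_bar3)
  finally show ?thesis
    by (simp add: bar_bar)
qed

lemma Q_skew4:
  assumes "CHAR('a) \<noteq> 2" "bar d = - d"
  shows "Q a b c d = 0"
proof -
  have "Q a b c d = Q a b c (bar d)"
    by (simp add: Q_bar4 bar_Q_fixed)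
  also have "\<dots> = - Q a b c d"
    unfolding assms(2) by (rule module_hom.neg) (rule Vector_Spaces.linear.axioms(3)[OF linear_Q])
  finally show ?thesis
    using assms(1) two_torsion_free by blast
qed

lemma Q_skew:
  assumes "CHAR('a) \<noteq> 2" "{a, b, c, d} \<inter> skew_elements bar \<noteq> {}"
  shows "Q a b c d = 0"
proof -
  consider "bar a = - a" | "bar b = - b" | "bar c = - c" | "bar d = - d"
    using assms(2) by (auto simp: skew_elements_def)
  then show ?thesis
    using Q_swap[of a b c d] Q_move2[of a b c d] Q_move3[of a b c d]
    by cases (simp_all add: Q_skew4[OF assms(1)])
qed

lemma Q_triple:
  "scale 3 (Q a b c x) =
     D_op (\<cdot>) bar a (bar b \<cdot> bar c) x + D_op (\<cdot>) bar b (bar c \<cdot> bar a) x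
   + D_op (\<cdot>) bar c (bar a \<cdot> bar b) x"
proof -
  have "scale 3 (Q a b c x) = Q a b c x + Q a b c x + Q a b c x"
    using scale_left_distrib[of 2 1 "Q a b c x"] scale_left_distrib[of 1 1 "Q a b c x"] by simp
  also have "\<dots> = Q a b c x + Q b c a x + Q c a b x"
    by (simp only: Q_cyc[of c a b x] Q_cyc[of a b c x])
  finally show ?thesis
    by (simp add: D_sum_eq)
qed

end

theorem theorem2p1:
  fixes scale :: "'f::field \<Rightarrow> 'a::ab_group_add \<Rightarrow> 'a"
    and mul :: "'a \<Rightarrow> 'a \<Rightarrow> 'a"
    and e :: 'a
    and bar :: "'a \<Rightarrow> 'a"
  assumes "pre_structurable_algebra scale mul e bar"
  shows
    "totally_symmetric4 (\<lambda>a b c d. Q_op mul bar a b c d)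
     \<and> (\<forall>a b c d. e \<in> {a, b, c, d} \<longrightarrow> Q_op mul bar a b c d = 0)
     \<and> (CHAR('f) \<noteq> 2 \<longrightarrow>
         (\<forall>a b c d. {a, b, c, d} \<inter> skew_elements bar \<noteq> {} \<longrightarrow> Q_op mul bar a b c d = 0))
     \<and> (\<forall>a b c.
          op_bar bar (Q_op mul bar a b c) = Q_op mul bar (bar a) (bar b) (bar c)
          \<and> Q_op mul bar (bar a) (bar b) (bar c) = Q_op mul bar a b c
          \<and> derivation scale mul (Q_op mul bar a b c))
     \<and> (\<forall>a b c x.
          scale 3 (Q_op mul bar a b c x) =
            D_op mul bar a (mul (bar b) (bar c)) x
          + D_op mul bar b (mul (bar c) (bar a)) x
          + D_op mul bar c (mul (bar a) (bar b)) x)"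
proof -
  interpret pre_structurable_algebra scale mul e bar
    by (fact assms)
  show ?thesis
    using Q_symmetric Q_unit Q_skew Q_bars Q_derivation Q_triple
    by (simp add: op_bar_def fun_eq_iff Q_bar4 bar_bar)
qed

end
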